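(* For $\lambda\in(0,\infty)\setminus\{1\}$ and integers $\ell\ge1$, set $\Psi(\lambda,\ell)=\frac{\lambda^{-\ell}}{1-\lambda^{-\ell}}$. Let $(V,E,\mathbf 1_r)$ be a root-reward tree. Let $v\in O$ have journey data $\{(s_i,d_i):0\le i\le k\}$, $k\in\{0,1,2,\dots\}$. (1) When $\lambda\in(0,\infty)\setminus\{1\}$, $$\mathrm{Stake}(1,\lambda,v)=\frac{(\lambda-1)\Psi(\lambda,s_k-d_k)}{(\lambda+1)\sum_{i=0}^k\Big((s_i-d_i)\Psi(\lambda,s_i-d_i)-s_i\Psi(\lambda,s_i)\Big)}.$$ (2) When $\lambda=1$, $$\mathrm{Stake}(1,1,v)=\Big((s_k-d_k)\sum_{i=0}^kd_i\Big)^{-1}.$$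
   Context: A root-reward tree $(V,E,\mathbf 1_r)$ consists of a finite rooted tree $(V,E)$ whose root $r$ is a leaf; $B$ is the set of all leaves (including $r$), $B^*=B\setminus\{r\}$, $O=V\setminus B$ is non-empty, and $p=\mathbf 1_r:B\to\{0,1\}$. $u\sim v$ denotes adjacency and $d$ graph distance. $d_{\rm in}(v)=d(r,v)$; $d_{\rm out}(v)$ is the minimum length of a path from $v$ to $B^*$ each of whose edges leads away from $r$; $\mathrm{span}(v)=d_{\rm in}(v)+d_{\rm out}(v)$. For $\lambda\in(0,\infty)$, $h(\lambda,\cdot):V\to[0,\infty)$ is the unique solution of: $h(\lambda,v)=p(v)$ for $v\in B$, and $h(\lambda,v)=\frac{\lambda}{\lambda+1}\max_{u\sim v}h(\lambda,u)+\frac1{\lambda+1}\min_{u\sim v}h(\lambda,u)$ for $v\in O$; it is differentiable in $\lambda$. For $v\in O$, $\Delta(\lambda,v)=\max_{w\sim v}h(\lambda,w)-\min_{w\sim v}h(\lambda,w)$ and $\mathrm{Stake}(\epsilon,\lambda,v)=\dfrac{\epsilon\,\Delta(\lambda,v)}{(\lambda+1)^2\frac{\partial}{\partial\lambda}h(\lambda,v)}$. Journey data of $v\ne r$: the junctions of $v$ are $r$, $v$, and those vertices $u\neq r$ on the path from $r$ to the parent of $v$ such that $\mathrm{span}(u_-)>\mathrm{span}(u)$, where $u_-$ is the successor of $u$ on the path $[r,v]$. List the junctions in the order met along $[r,v]$ as $j_0=r,j_1,\dots,j_k,j_{k+1}=v$. For $0\le i\le k$ set $d_i=d(j_i,j_{i+1})$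 and $s_i=d_i+d_{\rm out}(j_{i+1})$ (this is the span of the mainline rooted at $j_i$ of which $j_{i+1}$ is a non-root vertex, in the paper's decomposition of the tree). The journey data of $v$ is the list $\{(s_i,d_i):0\le i\le k\}$. *)

theory Defs
  imports "HOL-Analysis.Derivative" "Graph_Theory.Graph_Theory"
begin

definition Psi :: "real \<Rightarrow> int \<Rightarrow> real" where
  "Psi l n = l powi (- n) / (1 - l powi (- n))"

text \<open>
  A finite simple graph is a symmetric loop-free digraph. Each edge of such a digraph gives a
  directed cycle of length two, so acyclicity of the undirected graph means that no directed cycle
  has length three or more; the library's \<open>tree\<close>, which excludes every directed cycle, is meant
  for oriented graphs and does not apply.
\<close>

locale root_reward_tree = pair_graph G for G :: "'a pair_pre_digraph" +
  fixes r :: 'a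
  assumes connected: "Digraph_Component.connected G"
    and acyclic: "cycle c \<Longrightarrow> length c < 3"
    and root_in_verts: "r \<in> pverts G"
    and root_leaf: "out_degree G r = 1"
    and ex_non_leaf: "\<exists>v\<in>pverts G. out_degree G v \<noteq> 1"
begin

definition leaves :: "'a set" where
  "leaves = {v \<in> pverts G. out_degree G v = 1}"

definition non_leaves :: "'a set" where
  "non_leaves = pverts G - leaves"

definition nbrs :: "'a \<Rightarrow> 'a set" where
  "nbrs v = {u. v \<rightarrow>\<^bsub>G\<^esub> u}"

definition gdist :: "'a \<Rightarrow> 'a \<Rightarrow> nat" where
  "gdist u v = (LEAST n. \<exists>p. vwalk p G \<and> hd p = u \<and> last p = v \<and> vwalk_length p = n)"

definition d_in :: "'a \<Rightarrow> nat" where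
  "d_in v = gdist r v"

definition d_out :: "'a \<Rightarrow> nat" where
  "d_out v = (LEAST n. \<exists>p. vpath p G \<and> hd p = v \<and> last p \<in> leaves - {r} \<and>
     (\<forall>(x, y) \<in> set (vwalk_arcs p). d_in x < d_in y) \<and> vwalk_length p = n)"

definition vspan :: "'a \<Rightarrow> nat" where
  "vspan v = d_in v + d_out v"

definition payoff :: "'a \<Rightarrow> real" where
  "payoff v = (if v = r then 1 else 0)"

text \<open>
  Functions on the vertex set are represented as members of \<open>\<rightarrow>\<^sub>E\<close>, which fixes their value off
  the vertex set, so that uniqueness on the vertex set is uniqueness as a HOL function.
\<close>

definition is_value :: "real \<Rightarrow> ('a \<Rightarrow> real) \<Rightarrow> bool" where
  "is_value l f \<longleftrightarrow> f \<in> pverts G \<rightarrow>\<^sub>E {0..} \<and>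
     (\<forall>v\<in>leaves. f v = payoff v) \<and>
     (\<forall>v\<in>non_leaves. f v = l / (l + 1) * Max (f ` nbrs v) + 1 / (l + 1) * Min (f ` nbrs v))"

definition h :: "real \<Rightarrow> 'a \<Rightarrow> real" where
  "h l = (THE f. is_value l f)"

definition Delta :: "real \<Rightarrow> 'a \<Rightarrow> real" where
  "Delta l v = Max (h l ` nbrs v) - Min (h l ` nbrs v)"

definition Stake :: "real \<Rightarrow> real \<Rightarrow> 'a \<Rightarrow> real" where
  "Stake \<epsilon> l v = \<epsilon> * Delta l v / ((l + 1)\<^sup>2 * deriv (\<lambda>x. h x v) l)"

definition path_to :: "'a \<Rightarrow> 'a list" where
  "path_to v = (THE p. vpath p G \<and> hd p = r \<and> last p = v)"

text \<open>
  The junctions of \<open>v\<close> in the order in which they are met on the path from \<open>r\<close> to \<open>v\<close>. They are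
  selected by their position on this path: the first and last positions are those of \<open>r\<close> and \<open>v\<close>,
  and at any other position \<open>i\<close> the successor of the vertex is at position \<open>Suc i\<close>.
\<close>

definition junctions :: "'a \<Rightarrow> 'a list" where
  "junctions v = (let p = path_to v; n = vwalk_length p in
     map (\<lambda>i. p ! i)
       (filter (\<lambda>i. i = 0 \<or> i = n \<or> vspan (p ! Suc i) > vspan (p ! i)) [0..<Suc n]))"

definition journey_data :: "'a \<Rightarrow> (nat \<times> nat) list" where
  "journey_data v = (let js = junctions v in
     map (\<lambda>i. let d = gdist (js ! i) (js ! Suc i) in (d + d_out (js ! Suc i), d))
       [0..<length js - 1])"

end

end

theory Submission
  imports Defs
begin

text \<open>
  On a path with payoff \<open>1\<close> at one end and \<open>0\<close> at the other, the value at distance \<open>n\<close> from the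
  zero end is proportional to \<open>1 - l^(-n)\<close>, or to \<open>n\<close> if \<open>l = 1\<close>. In the tree, each vertex other
  than the root should behave as if it stood at distance \<open>d_out\<close> from the zero end of such a path.
  So \<open>h\<close> gains, on each step from a parent to its child \<open>w\<close>, the factor \<open>weight l (d_out w)\<close>, the
  ratio of the path values at distances \<open>d_out w\<close> and \<open>d_out w + 1\<close>. The candidate \<open>tree_value\<close> is
  the product of these factors along the path from the root. The factors are at most \<open>1\<close> and do
  not decrease when \<open>d_out\<close> grows, so at an inner vertex \<open>v\<close> the parent has the largest value among
  the neighbours, and a child with \<open>d_out\<close> one smaller than at \<open>v\<close> has the smallest. The defining
  equation then reduces to the recurrence \<open>weight_recurrence\<close> for the path. The equation has at
  most one solution (\<open>is_value_le\<close>, a maximum principle), so \<open>h = tree_value\<close>.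

  The factor \<open>h l v\<close> cancels between \<open>Delta\<close> and the derivative of \<open>h\<close>. What remains is an
  explicit function of \<open>d_out v\<close>, divided by the sum of the logarithmic derivatives of the factors
  along the path (\<open>Stake_eq\<close>). At \<open>l = 1\<close> every factor contributes \<open>1 / 2\<close>, and the sum is half
  the depth of \<open>v\<close>. Otherwise, with \<open>F n = n * Psi l n\<close>, the factor at \<open>w\<close> contributes
  \<open>(F n - F (n + 1)) / l\<close> for \<open>n = d_out w\<close>. Between consecutive junctions
  \<open>d_out\<close> drops by one at each step (\<open>journey_data_segments\<close>), so these contributions telescope and each journey entry \<open>(s, d)\<close>
  leaves \<open>F (s - d) - F s\<close>.
\<close>

section \<open>Distance to the root and the parent of a vertex\<close>

context root_reward_tree
begin

lemma arc_sym: "(x, y) \<in> parcs G \<Longrightarrow> (y, x) \<in> parcs G"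
  by (rule arcs_symmetric)

lemma nbrs_altdef: "nbrs v = {u. (v, u) \<in> parcs G}"
  by (simp add: nbrs_def)

lemma finite_nbrs: "finite (nbrs v)"
  by (rule finite_subset[of _ "pverts G"]) (auto simp: nbrs_altdef pair_finite_verts dest: in_arcsD2)

lemma out_degree_card_nbrs: "out_degree G v = card (nbrs v)"
proof -
  have "out_arcs G v = Pair v ` nbrs v"
    by (auto simp: nbrs_altdef out_arcs_def)
  then show ?thesis
    by (simp add: out_degree_def card_image inj_on_def)
qed

lemma vwalk_between:
  assumes "u \<in> pverts G" "v \<in> pverts G"
  shows "\<exists>p. vwalk p G \<and> hd p = u \<and> last p = v"
proof -
  have "strongly_connected G"
    using connected pair_sym_arcs symmetric_connected_imp_strongly_connected by blast
  then have "u \<rightarrow>\<^sup>*\<^bsub>with_proj G\<^esub> v"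
    using assms by (auto simp: strongly_connected_def)
  then show ?thesis
    by (simp add: reachable_vwalk_conv)
qed

lemma geodesic_exists:
  assumes "u \<in> pverts G" "v \<in> pverts G"
  obtains p where "vwalk p G" "hd p = u" "last p = v" "length p = Suc (gdist u v)"
proof -
  obtain p where p: "vwalk p G" "hd p = u" "last p = v"
    using vwalk_between[OF assms] by blast
  have "\<exists>q. vwalk q G \<and> hd q = u \<and> last q = v \<and> vwalk_length q = gdist u v"
    unfolding gdist_def by (rule LeastI) (use p in blast)
  then obtain q where q: "vwalk q G" "hd q = u" "last q = v" "vwalk_length q = gdist u v"
    by blast
  then have "length q = Suc (gdist u v)"
    by (cases q) auto
  then show ?thesis using that q by blast
qed

lemma gdist_le_walk:
  assumes "vwalk p G"
  shows "gdist (hd p) (last p) \<le> length p - 1"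
  unfolding gdist_def using assms by (intro Least_le) auto

lemma d_in_root: "d_in r = 0"
  using gdist_le_walk[of "[r]"] root_in_verts by (simp add: d_in_def)

lemma vwalk_snocI:
  assumes "vwalk p G" "(last p, v) \<in> parcs G"
  shows "vwalk (p @ [v]) G"
  using assms in_arcsD2[OF assms(2)] by (auto simp: vwalk_def vwalk_arcs_append)

lemma d_in_arc_le:
  assumes "(u, v) \<in> parcs G"
  shows "d_in v \<le> Suc (d_in u)"
proof -
  obtain p where p: "vwalk p G" "hd p = r" "last p = u" "length p = Suc (gdist r u)"
    using geodesic_exists[OF root_in_verts in_arcsD1[OF assms]] by blast
  have "vwalk (p @ [v]) G"
    using p assms by (intro vwalk_snocI) auto
  from gdist_le_walk[OF this] p show ?thesis
    by (cases p) (auto simp: d_in_def)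
qed

lemma d_in_zero:
  assumes "v \<in> pverts G" "d_in v = 0"
  shows "v = r"
proof -
  obtain p where "hd p = r" "last p = v" "length p = Suc 0"
    using geodesic_exists[OF root_in_verts assms(1)] assms(2) unfolding d_in_def by metis
  then show ?thesis by (cases p) auto
qed

lemma ex_parent:
  assumes "v \<in> pverts G" "v \<noteq> r"
  shows "\<exists>u. (u, v) \<in> parcs G \<and> d_in v = Suc (d_in u)"
proof -
  obtain p where p: "vwalk p G" "hd p = r" "last p = v" "length p = Suc (gdist r v)"
    using geodesic_exists[OF root_in_verts assms(1)] by blast
  obtain q where q: "p = q @ [v]"
    using p by (metis append_butlast_last_id list.size(3) nat.distinct(1))
  have "q \<noteq> []" using p q assms by auto
  then have w: "vwalk q G" and e: "(last q, v) \<in> parcs G"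
    using p(1) q by (auto simp: vwalk_def vwalk_arcs_append)
  have "d_in (last q) \<le> length q - 1"
    using gdist_le_walk[OF w] p q \<open>q \<noteq> []\<close> by (auto simp: d_in_def)
  then have "Suc (d_in (last q)) \<le> d_in v"
    using p q \<open>q \<noteq> []\<close> by (cases q) (auto simp: d_in_def)
  then show ?thesis
    using e d_in_arc_le[OF e] by (intro exI[of _ "last q"]) auto
qed

lemma awalk_vwalk_arcs:
  assumes "vwalk p G"
  shows "awalk (hd p) (vwalk_arcs p) (last p) \<and> pawalk_verts (hd p) (vwalk_arcs p) = p"
  using assms
  by (induction p rule: vwalk_induct) (auto simp: awalk_def dest: in_arcsD1 in_arcsD2)

text \<open>
  This is the form in which the absence of cycles is used: a path on at least three vertices cannot
  be closed by an arc between its ends.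
\<close>

lemma no_closing_arc:
  assumes "vpath p G" "length p \<ge> 3" "(last p, hd p) \<in> parcs G"
  shows False
proof -
  let ?p = "p @ [hd p]"
  have ne: "p \<noteq> []" using assms by auto
  have "vwalk ?p G"
    using assms by (intro vwalk_snocI) (auto elim: vpathE)
  from awalk_vwalk_arcs[OF this]
  have a: "awalk (hd p) (vwalk_arcs ?p) (hd p)" "pawalk_verts (hd p) (vwalk_arcs ?p) = ?p"
    using ne by auto
  have len: "length (vwalk_arcs ?p) = length p"
    using vwalk_length_simp[of ?p] unfolding vwalk_length_def by simp
  have "distinct (tl ?p)"
    using assms(1) ne by (cases p) (auto simp: vpath_def)
  then have "cycle (vwalk_arcs ?p)"
    unfolding cycle_def using a len assms(2) by (intro exI[of _ "hd p"]) auto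
  from acyclic[OF this] len assms(2) show False by simp
qed

text \<open>
  Following parents from two vertices at the same level until the two lines meet gives a path that
  stays at this level or nearer to the root. Any further connection of its ends closes a
  cycle, so this path is what excludes horizontal edges and second parents.
\<close>

lemma same_level_path:
  assumes "x \<in> pverts G" "y \<in> pverts G" "d_in x = n" "d_in y = n" "x \<noteq> y"
  shows "\<exists>p. vpath p G \<and> hd p = x \<and> last p = y \<and> length p \<ge> 3 \<and> (\<forall>z\<in>set p. d_in z \<le> n)"
  using assms
proof (induction n arbitrary: x y)
  case 0
  then show ?case using d_in_zero by blast
next
  case (Suc n)
  have "x \<noteq> r" "y \<noteq> r" using Suc.prems d_in_root by auto
  then obtain x' y' where x': "(x', x) \<in> parcs G" "d_in x' = n"
    and y': "(y', y) \<in> parcs G" "d_in y' = n"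
    using ex_parent[of x] ex_parent[of y] Suc.prems by fastforce
  have xn: "x' \<noteq> x" "x' \<noteq> y" "y' \<noteq> x" "y' \<noteq> y"
    using x' y' Suc.prems by auto
  have v': "x' \<in> pverts G" "y' \<in> pverts G"
    using x' y' in_arcsD1 by auto
  show ?case
  proof (cases "x' = y'")
    case True
    have "vpath [x, x', y] G"
      using xn True x' y' Suc.prems v' arc_sym[OF x'(1)] by (auto simp: vpath_def vwalk_def)
    then show ?thesis using x' Suc.prems
      by (intro exI[of _ "[x, x', y]"]) auto
  next
    case False
    obtain p where p: "vpath p G" "hd p = x'" "last p = y'" "length p \<ge> 3" "\<forall>z\<in>set p. d_in z \<le> n"
      using Suc.IH[OF v' x'(2) y'(2) False] by blast
    have ne: "p \<noteq> []" using p(4) by auto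
    have out: "x \<notin> set p" "y \<notin> set p" using p(5) Suc.prems by auto
    have "vwalk (x # p) G"
      using p(1,2) arc_sym[OF x'(1)] Suc.prems(1) by (intro vwalk_consI) (auto simp: vpath_def)
    from vwalk_snocI[OF this, of y] have "vwalk (x # p @ [y]) G"
      using p(3) ne y'(1) by simp
    then have "vpath (x # p @ [y]) G"
      using p(1) out Suc.prems(5) by (simp add: vpath_def)
    moreover have "\<forall>z\<in>set (x # p @ [y]). d_in z \<le> Suc n"
      using p(5) Suc.prems(3,4) by (simp add: le_SucI)
    ultimately show ?thesis using p(4) by (intro exI[of _ "x # p @ [y]"]) simp
  qed
qed

lemma d_in_arc_neq:
  assumes "(x, y) \<in> parcs G"
  shows "d_in x \<noteq> d_in y"
proof
  assume eq: "d_in x = d_in y"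
  obtain p where p: "vpath p G" "hd p = x" "last p = y" "length p \<ge> 3"
    using same_level_path[OF in_arcsD1[OF assms] in_arcsD2[OF assms] refl eq[symmetric]
        no_loops'[OF assms]] by blast
  show False using no_closing_arc[OF p(1,4)] p(2,3) arc_sym[OF assms] by simp
qed

lemma d_in_arc_cases:
  assumes "(x, y) \<in> parcs G"
  shows "d_in y = Suc (d_in x) \<or> d_in x = Suc (d_in y)"
  using d_in_arc_le[OF assms] d_in_arc_le[OF arc_sym[OF assms]] d_in_arc_neq[OF assms] by linarith

lemma parent_unique:
  assumes "(x, z) \<in> parcs G" "d_in z = Suc (d_in x)" "(y, z) \<in> parcs G" "d_in z = Suc (d_in y)"
  shows "x = y"
proof (rule ccontr)
  assume "x \<noteq> y"
  then obtain p where p: "vpath p G" "hd p = x" "last p = y" "length p \<ge> 3"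
      "\<forall>w\<in>set p. d_in w \<le> d_in x"
    using same_level_path[of x y "d_in x"] assms in_arcsD1 by auto
  have "vwalk (p @ [z]) G"
    using p assms by (intro vwalk_snocI) (auto simp: vpath_def)
  then have "vpath (p @ [z]) G"
    using p assms by (auto simp: vpath_def)
  moreover have "(last (p @ [z]), hd (p @ [z])) \<in> parcs G"
    using p(2,4) arc_sym[OF assms(1)] by (cases p) auto
  ultimately show False using no_closing_arc[of "p @ [z]"] p(4) by simp
qed

definition parent :: "'a \<Rightarrow> 'a" where
  "parent v = (THE u. (u, v) \<in> parcs G \<and> d_in v = Suc (d_in u))"

lemma parent_eqI:
  assumes "(u, v) \<in> parcs G" "d_in v = Suc (d_in u)"
  shows "parent v = u"
  unfolding parent_def
proof (rule the_equality)
  show "x = u" if "(x, v) \<in> parcs G \<and> d_in v = Suc (d_in x)" for x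
    using parent_unique[of x v u] that assms by simp
qed (use assms in simp)

lemma parent_props:
  assumes "v \<in> pverts G" "v \<noteq> r"
  shows parent_arc: "(parent v, v) \<in> parcs G"
    and d_in_parent: "d_in v = Suc (d_in (parent v))"
    and parent_in_verts: "parent v \<in> pverts G"
proof -
  obtain u where u: "(u, v) \<in> parcs G" "d_in v = Suc (d_in u)"
    using ex_parent[OF assms] by blast
  with parent_eqI[OF u] show "(parent v, v) \<in> parcs G" "d_in v = Suc (d_in (parent v))"
    by auto
  then show "parent v \<in> pverts G" by (auto dest: in_arcsD1)
qed

definition children :: "'a \<Rightarrow> 'a set" where
  "children v = {c. (v, c) \<in> parcs G \<and> d_in c = Suc (d_in v)}"

lemma child_in_verts: "c \<in> children v \<Longrightarrow> c \<in> pverts G"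
  by (auto simp: children_def dest: in_arcsD2)

lemma child_neq_root: "c \<in> children v \<Longrightarrow> c \<noteq> r"
  by (auto simp: children_def d_in_root)

lemma parent_child: "c \<in> children v \<Longrightarrow> parent c = v"
  by (auto simp: children_def intro: parent_eqI)

lemma nbrs_eq:
  assumes "v \<in> pverts G" "v \<noteq> r"
  shows "nbrs v = insert (parent v) (children v)"
proof
  show "nbrs v \<subseteq> insert (parent v) (children v)"
  proof
    fix u assume "u \<in> nbrs v"
    then have e: "(v, u) \<in> parcs G" by (simp add: nbrs_altdef)
    show "u \<in> insert (parent v) (children v)"
      using d_in_arc_cases[OF e] parent_eqI[OF arc_sym[OF e]] e by (auto simp: children_def)
  qed
  show "insert (parent v) (children v) \<subseteq> nbrs v"
    using arc_sym[OF parent_arc[OF assms]] by (auto simp: nbrs_altdef children_def)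
qed

lemma parent_notin_children:
  assumes "v \<in> pverts G" "v \<noteq> r"
  shows "parent v \<notin> children v"
  using d_in_parent[OF assms] by (auto simp: children_def)

lemma finite_children: "finite (children v)"
  by (rule finite_subset[OF _ finite_nbrs[of v]]) (auto simp: nbrs_altdef children_def)

text \<open>
  A vertex other than the root has its parent as a neighbour, so it has degree one exactly if it has
  no child.
\<close>

lemma leaf_iff:
  assumes "v \<in> pverts G" "v \<noteq> r"
  shows "v \<in> leaves \<longleftrightarrow> children v = {}"
  using assms finite_children[of v] parent_notin_children[OF assms]
  by (simp add: leaves_def out_degree_card_nbrs nbrs_eq)

lemma root_in_leaves: "r \<in> leaves"
  using root_in_verts root_leaf by (simp add: leaves_def)

lemma non_leavesD:
  assumes "v \<in> non_leaves"
  shows "v \<in> pverts G" "v \<noteq> r" "children v \<noteq> {}"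
  using assms leaf_iff[of v] root_in_leaves by (auto simp: non_leaves_def)

section \<open>The path from the root\<close>

text \<open>
  A path starting at the root can never turn back, because a step towards the root leads to the
  parent, where the path has just been.
\<close>

lemma vpath_from_root_d_in:
  assumes "vpath p G" "hd p = r" "i < length p"
  shows "d_in (p ! i) = i"
  using assms(3)
proof (induction i rule: less_induct)
  case (less i)
  show ?case
  proof (cases i)
    case 0
    then show ?thesis using assms less.prems d_in_root by (simp add: hd_conv_nth)
  next
    case (Suc j)
    have arc: "(p ! m, p ! Suc m) \<in> parcs G" if "Suc m < length p" for m
      using assms(1) that
    proof (induction p arbitrary: m)
      case (Cons x xs)
      show ?case
      proof (cases xs)
        case (Cons y ys)
        then show ?thesis using Cons.prems Cons.IH[of "m - 1"]
          by (cases m) (auto simp: vpath_def)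
      qed (use Cons.prems in auto)
    qed auto
    have e: "(p ! j, p ! i) \<in> parcs G" and dj: "d_in (p ! j) = j"
      using arc[of j] less Suc by auto
    \<comment> \<open>A step back towards the root would go to the unique parent, which is the preceding vertex
      of the path.\<close>
    have "d_in (p ! j) \<noteq> Suc (d_in (p ! i))"
    proof
      assume up: "d_in (p ! j) = Suc (d_in (p ! i))"
      then obtain m where m: "j = Suc m" using dj by (cases j) auto
      have "(p ! m, p ! j) \<in> parcs G" "d_in (p ! m) = m"
        using arc[of m] less Suc m by auto
      then have "p ! m = p ! i"
        using parent_unique[of "p ! m" "p ! j" "p ! i"] up arc_sym[OF e] dj m by auto
      then show False
        using assms(1) less.prems Suc m by (auto simp: vpath_def nth_eq_iff_index_eq)
    qed
    then show ?thesis using d_in_arc_cases[OF e] dj Suc by auto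
  qed
qed

lemma vpath_from_root_unique:
  assumes "vpath p G" "hd p = r" "last p = v" "vpath q G" "hd q = r" "last q = v"
  shows "p = q"
  using assms
proof (induction "length p" arbitrary: p q v)
  case 0
  then show ?case by (auto simp: vpath_def)
next
  case (Suc n)
  have ne: "p \<noteq> []" "q \<noteq> []" using Suc.prems by (auto simp: vpath_def)
  have d: "d_in v = length w - 1" if "vpath w G" "hd w = r" "last w = v" for w
    using vpath_from_root_d_in[OF that(1,2), of "length w - 1"] that
    by (auto simp: vpath_def last_conv_nth)
  have len: "length q = length p"
    using d[OF Suc.prems(1-3)] d[OF Suc.prems(4-6)] ne by (cases p; cases q) auto
  show ?case
  proof (cases "n = 0")
    case True
    then have "length p = 1" "length q = 1" using len Suc.hyps(2) by auto
    then show ?thesis using Suc.prems by (auto simp: length_Suc_conv)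
  next
    case False
    have step: "vpath (butlast w) G \<and> hd (butlast w) = r \<and> last (butlast w) = parent v"
      if w: "vpath w G" "hd w = r" "last w = v" "length w = Suc n" for w
    proof -
      obtain w' where w': "w = w' @ [v]" "w' \<noteq> []"
        using w False by (metis append_butlast_last_id append_self_conv2 length_0_conv
          length_append_singleton nat.inject nat.distinct(1))
      have "vpath w' G" "(last w', v) \<in> parcs G"
        using w(1) w' by (auto simp: vpath_def vwalk_def vwalk_arcs_append)
      moreover have "d_in (last w') = n - 1"
        using vpath_from_root_d_in[OF w(1,2), of "n - 1"] w' w(4) False
        by (simp add: nth_append last_conv_nth)
      moreover have "d_in v = n" using d[OF w(1-3)] w(4) by simp
      ultimately show ?thesis using w(2) w' False parent_eqI[of "last w'" v] by auto
    qed
    have "butlast p = butlast q"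
      using Suc.hyps(1)[of "butlast p" "parent v" "butlast q"] step[of p] step[of q]
        Suc.prems Suc.hyps(2) len by auto
    then show ?thesis using Suc.prems ne by (metis append_butlast_last_id)
  qed
qed

lemma path_to_eqI:
  assumes "vpath p G" "hd p = r" "last p = v"
  shows "path_to v = p"
  unfolding path_to_def
proof (rule the_equality)
  show "q = p" if "vpath q G \<and> hd q = r \<and> last q = v" for q
    using vpath_from_root_unique[OF _ _ _ assms, of q] that by simp
qed (use assms in simp)

lemma path_to_props:
  assumes "v \<in> pverts G"
  shows vpath_path_to: "vpath (path_to v) G" and hd_path_to: "hd (path_to v) = r"
    and last_path_to: "last (path_to v) = v"
proof -
  obtain p where "vpath p G" "hd p = r" "last p = v"
    using vwalk_between[OF root_in_verts assms] vwalk_imp_ex_vpath by metis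
  with path_to_eqI[OF this] show "vpath (path_to v) G" "hd (path_to v) = r" "last (path_to v) = v"
    by simp_all
qed

lemma path_to_nonempty: "v \<in> pverts G \<Longrightarrow> path_to v \<noteq> []"
  using vpath_path_to by (auto simp: vpath_def)

lemma d_in_path_to_nth: "v \<in> pverts G \<Longrightarrow> i < length (path_to v) \<Longrightarrow> d_in (path_to v ! i) = i"
  using vpath_from_root_d_in vpath_path_to hd_path_to by blast

lemma length_path_to:
  assumes "v \<in> pverts G"
  shows "length (path_to v) = Suc (d_in v)"
  using d_in_path_to_nth[OF assms, of "length (path_to v) - 1"] last_path_to[OF assms]
    path_to_nonempty[OF assms] by (cases "path_to v") (auto simp: last_conv_nth)

lemma path_to_root: "path_to r = [r]"
  by (rule path_to_eqI) (auto simp: vpath_def root_in_verts)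

lemma path_to_parent:
  assumes "v \<in> pverts G" "v \<noteq> r"
  shows "path_to v = path_to (parent v) @ [v]"
proof (rule path_to_eqI)
  let ?p = "path_to (parent v)"
  note pv = parent_in_verts[OF assms]
  have "vwalk (?p @ [v]) G"
    using vpath_path_to[OF pv] last_path_to[OF pv] parent_arc[OF assms]
    by (intro vwalk_snocI) (auto simp: vpath_def)
  moreover have "v \<notin> set ?p"
  proof
    assume "v \<in> set ?p"
    then obtain i where "i < length ?p" "?p ! i = v" by (auto simp: in_set_conv_nth)
    then show False
      using d_in_path_to_nth[OF pv, of i] length_path_to[OF pv] d_in_parent[OF assms] by auto
  qed
  ultimately show "vpath (?p @ [v]) G"
    using vpath_path_to[OF pv] by (auto simp: vpath_def)
  show "hd (?p @ [v]) = r" using hd_path_to[OF pv] path_to_nonempty[OF pv] by simp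
qed simp

lemma path_to_nth_in_verts: "v \<in> pverts G \<Longrightarrow> i < length (path_to v) \<Longrightarrow> path_to v ! i \<in> pverts G"
  using vpath_path_to[of v] by (auto simp: vpath_def vwalk_def)

lemma path_to_nth_child:
  assumes "v \<in> pverts G" "Suc i < length (path_to v)"
  shows "path_to v ! Suc i \<in> children (path_to v ! i)"
  using assms
proof (induction "d_in v" arbitrary: v)
  case 0
  then show ?case using length_path_to by simp
next
  case (Suc n)
  have nr: "v \<noteq> r" using Suc.hyps(2) d_in_root by auto
  note pv = parent_in_verts[OF Suc.prems(1) nr]
  note eq = path_to_parent[OF Suc.prems(1) nr]
  have dp: "d_in (parent v) = n" using d_in_parent[OF Suc.prems(1) nr] Suc.hyps(2) by simp
  have len: "length (path_to (parent v)) = Suc n" using length_path_to[OF pv] dp by simp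
  show ?case
  proof (cases "Suc i < length (path_to (parent v))")
    case True
    then show ?thesis using Suc.hyps(1)[OF dp[symmetric] pv True] eq by (simp add: nth_append)
  next
    case False
    then have i: "i = n" using Suc.prems(2) eq len by simp
    then have "path_to v ! i = parent v" "path_to v ! Suc i = v"
      using eq len last_path_to[OF pv] path_to_nonempty[OF pv]
      by (auto simp: nth_append last_conv_nth)
    then show ?thesis using parent_arc[OF Suc.prems(1) nr] d_in_parent[OF Suc.prems(1) nr]
      by (simp add: children_def)
  qed
qed

section \<open>Distance to the exits\<close>

text \<open>
  The paths over which \<open>d_out\<close> minimises the length.
\<close>

definition exit_path :: "'a \<Rightarrow> 'a list \<Rightarrow> bool" where
  "exit_path v p \<longleftrightarrow> vpath p G \<and> hd p = v \<and> last p \<in> leaves - {r} \<and>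
     (\<forall>(x, y) \<in> set (vwalk_arcs p). d_in x < d_in y)"

lemma d_out_exit_path: "d_out v = (LEAST n. \<exists>p. exit_path v p \<and> vwalk_length p = n)"
  by (simp add: d_out_def exit_path_def conj_assoc)

lemma exit_path_d_in_ge:
  assumes "exit_path v p" "z \<in> set p"
  shows "d_in v \<le> d_in z"
proof -
  have "\<forall>z\<in>set p. d_in (hd p) \<le> d_in z" if "\<forall>(x, y) \<in> set (vwalk_arcs p). d_in x < d_in y" for p
    using that by (induction p rule: vwalk_arcs.induct) auto
  then show ?thesis using assms by (auto simp: exit_path_def)
qed

lemma exit_path_singleton: "v \<in> leaves \<Longrightarrow> v \<noteq> r \<Longrightarrow> exit_path v [v]"
  by (auto simp: exit_path_def vpath_def leaves_def)

lemma exit_path_Cons: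
  assumes "c \<in> children v" "exit_path c p"
  shows "exit_path v (v # p)"
proof -
  have e: "(v, c) \<in> parcs G" "d_in c = Suc (d_in v)"
    using assms(1) by (auto simp: children_def)
  have ne: "p \<noteq> []" using assms(2) by (auto simp: exit_path_def vpath_def)
  have "v \<notin> set p" using exit_path_d_in_ge[OF assms(2), of v] e by auto
  moreover have "vwalk (v # p) G"
    using assms(2) e in_arcsD1[OF e(1)] by (intro vwalk_consI) (auto simp: exit_path_def vpath_def)
  ultimately show ?thesis
    using assms(2) e ne by (auto simp: exit_path_def vpath_def)
qed

lemma exit_path_first_step:
  assumes "exit_path v p" "v \<notin> leaves"
  shows "\<exists>c\<in>children v. \<exists>q. p = v # q \<and> exit_path c q"
proof -
  obtain q where q: "p = v # q" "q \<noteq> []"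
    using assms by (cases p) (auto simp: exit_path_def vpath_def split: if_splits)
  have e: "(v, hd q) \<in> parcs G" "d_in v < d_in (hd q)"
    using assms(1) q by (auto simp: exit_path_def vpath_def vwalk_def)
  then have "hd q \<in> children v"
    using d_in_arc_cases[OF e(1)] by (auto simp: children_def)
  moreover have "exit_path (hd q) q"
    using assms(1) q by (auto simp: exit_path_def vpath_def vwalk_def)
  ultimately show ?thesis using q by blast
qed

text \<open>
  This shows that the minimum defining \<open>d_out\<close> is taken over a non-empty set. Walking away from the
  root must stop, since the depth is bounded, and it can stop only at a leaf.
\<close>

lemma ex_exit_path:
  assumes "v \<in> pverts G" "v \<noteq> r"
  shows "\<exists>p. exit_path v p"
  using assms
proof (induction "Max (d_in ` pverts G) - d_in v" arbitrary: v rule: less_induct)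
  case less
  show ?case
  proof (cases "v \<in> leaves")
    case True
    then show ?thesis using exit_path_singleton less.prems by blast
  next
    case False
    then obtain c where c: "c \<in> children v" using leaf_iff[OF less.prems] by auto
    have "d_in c \<le> Max (d_in ` pverts G)"
      using child_in_verts[OF c] pair_finite_verts by (intro Max_ge) auto
    moreover have "d_in c = Suc (d_in v)"
      using c by (simp add: children_def)
    ultimately have "Max (d_in ` pverts G) - d_in c < Max (d_in ` pverts G) - d_in v" by linarith
    then obtain p where "exit_path c p"
      using less.hyps[of c] child_in_verts[OF c] child_neq_root[OF c] by blast
    then show ?thesis using exit_path_Cons[OF c] by blast
  qed
qed

lemma d_out_le: "exit_path v p \<Longrightarrow> d_out v \<le> length p - 1"
  unfolding d_out_exit_path by (rule Least_le) auto

lemma d_out_attained: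
  assumes "v \<in> pverts G" "v \<noteq> r"
  obtains p where "exit_path v p" "length p = Suc (d_out v)"
proof -
  have "\<exists>p. exit_path v p \<and> vwalk_length p = d_out v"
    unfolding d_out_exit_path by (rule LeastI_ex) (use ex_exit_path[OF assms] in blast)
  then obtain p where p: "exit_path v p" "vwalk_length p = d_out v" by blast
  then have "length p = Suc (d_out v)" by (cases p) (auto simp: exit_path_def vpath_def)
  then show ?thesis using that p by blast
qed

lemma d_out_leaf: "v \<in> leaves \<Longrightarrow> v \<noteq> r \<Longrightarrow> d_out v = 0"
  using d_out_le[OF exit_path_singleton] by simp

lemma d_out_pos:
  assumes "v \<in> non_leaves"
  shows "d_out v > 0"
proof (rule ccontr)
  assume "\<not> d_out v > 0"
  then obtain p where "exit_path v p" "length p = 1"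
    using d_out_attained[OF non_leavesD(1,2)[OF assms]] by auto
  then have "v \<in> leaves" by (cases p) (auto simp: exit_path_def)
  then show False using assms by (simp add: non_leaves_def)
qed

lemma d_out_le_child:
  assumes "c \<in> children v"
  shows "d_out v \<le> Suc (d_out c)"
proof -
  obtain p where p: "exit_path c p" "length p = Suc (d_out c)"
    using d_out_attained[OF child_in_verts[OF assms] child_neq_root[OF assms]] .
  show ?thesis using d_out_le[OF exit_path_Cons[OF assms p(1)]] p(2) by simp
qed

lemma ex_mainline_child:
  assumes "v \<in> non_leaves"
  shows "\<exists>c\<in>children v. d_out v = Suc (d_out c)"
proof -
  obtain p where p: "exit_path v p" "length p = Suc (d_out v)"
    using d_out_attained[OF non_leavesD(1,2)[OF assms]] .
  obtain c q where c: "c \<in> children v" "p = v # q" "exit_path c q"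
    using exit_path_first_step[OF p(1)] assms by (auto simp: non_leaves_def)
  have "Suc (d_out c) \<le> d_out v"
    using d_out_le[OF c(3)] p(2) c(2) d_out_pos[OF assms] by simp
  with d_out_le_child[OF c(1)] c(1) show ?thesis by force
qed

end

section \<open>The value ratio between a vertex and its parent\<close>

definition geom :: "real \<Rightarrow> nat \<Rightarrow> real" where
  "geom l n = (\<Sum>i<n. l ^ i)"

text \<open>
  For \<open>l > 0\<close> other than \<open>1\<close> this is \<open>(1 - l^(-n)) / (1 - l^(-(n+1)))\<close>. Geometric sums in place of
  the powers cover \<open>l = 1\<close> as well, and make positivity and differentiability there immediate.
\<close>

definition weight :: "real \<Rightarrow> nat \<Rightarrow> real" where
  "weight l n = l * geom l n / geom l (Suc n)"

lemma geom_Suc: "geom l (Suc n) = 1 + l * geom l n"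
  unfolding geom_def by (subst sum.lessThan_Suc_shift) (simp add: sum_distrib_left)

lemma geom_nonneg: "l > 0 \<Longrightarrow> geom l n \<ge> 0"
  unfolding geom_def by (intro sum_nonneg) auto

lemma geom_Suc_pos: "l > 0 \<Longrightarrow> geom l (Suc n) > 0"
  using geom_nonneg[of l n] by (simp add: geom_Suc add_pos_nonneg)

lemma geom_pos: "l > 0 \<Longrightarrow> n > 0 \<Longrightarrow> geom l n > 0"
  using geom_Suc_pos[of l "n - 1"] by simp

lemma geom_one: "geom 1 n = real n"
  by (simp add: geom_def)

lemma geom_closed: "l \<noteq> 1 \<Longrightarrow> geom l n = (l ^ n - 1) / (l - 1)"
  by (simp add: geom_def geometric_sum)

lemma weight_zero: "weight l 0 = 0"
  by (simp add: weight_def geom_def)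

lemma weight_pos: "l > 0 \<Longrightarrow> n > 0 \<Longrightarrow> weight l n > 0"
  by (simp add: weight_def geom_pos)

lemma weight_eq: "l > 0 \<Longrightarrow> weight l n = 1 - 1 / geom l (Suc n)"
  using geom_Suc_pos[of l n] by (simp add: weight_def field_simps geom_Suc)

lemma weight_le_one: "l > 0 \<Longrightarrow> weight l n \<le> 1"
  using geom_Suc_pos[of l n] by (simp add: weight_eq)

lemma weight_mono:
  assumes "l > 0" "m \<le> n"
  shows "weight l m \<le> weight l n"
proof -
  have "geom l (Suc m) \<le> geom l (Suc n)"
    unfolding geom_def using assms by (intro sum_mono2) auto
  then show ?thesis
    using geom_Suc_pos[OF assms(1), of m] by (simp add: weight_eq assms(1) divide_left_mono)
qed

text \<open>
  This is \<open>l + 1\<close> times the value equation on a path, scaled to the previous vertex: the neighbours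
  of a vertex of value \<open>weight l (n + 1)\<close> have values \<open>1\<close> and \<open>weight l (n + 1) * weight l n\<close>.
\<close>

lemma weight_recurrence:
  assumes "l > 0"
  shows "l + weight l (Suc n) * weight l n = (l + 1) * weight l (Suc n)"
proof -
  have g: "geom l (Suc n) > 0" "geom l (Suc (Suc n)) > 0"
    using geom_Suc_pos assms by blast+
  have "weight l (Suc n) * weight l n = l * (l * geom l n) / geom l (Suc (Suc n))"
    using g by (simp add: weight_def)
  also have "l * (l * geom l n) = (l + 1) * (l * geom l (Suc n)) - l * geom l (Suc (Suc n))"
    by (simp add: geom_Suc algebra_simps)
  finally show ?thesis
    using g by (simp add: weight_def diff_divide_distrib)
qed

lemma Psi_nat:
  assumes "l > 0"
  shows "Psi l (int n) = 1 / (l ^ n - 1)"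
proof -
  have "l powi (- int n) = 1 / l ^ n"
    by (simp add: power_int_minus inverse_eq_divide)
  moreover have "1 / p / (1 - 1 / p) = 1 / (p - 1)" if "p > 0" for p :: real
    using that by (cases "p = 1") (auto simp: field_simps)
  ultimately show ?thesis using assms by (simp only: Psi_def zero_less_power)
qed

lemma power_neq_one:
  fixes l :: real
  assumes "l > 0" "l \<noteq> 1" "n > 0"
  shows "l ^ n \<noteq> 1"
  using assms power_eq_imp_eq_base[of l n 1] by auto

text \<open>
  The logarithmic derivative of \<open>geom\<close> in \<open>l\<close>, for \<open>n > 0\<close>. Off \<open>l = 1\<close> it is split so that the
  summand \<open>1 / (l - 1)\<close> is common to all \<open>n\<close> and cancels in the quotient \<open>weight\<close>.
\<close>

definition geom_log_deriv :: "real \<Rightarrow> nat \<Rightarrow> real" where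
  "geom_log_deriv l n =
     (if l = 1 then (real n - 1) / 2 else real n * (1 + Psi l (int n)) / l - 1 / (l - 1))"

lemma geom_has_derivative:
  assumes "l > 0" "n > 0"
  shows "((\<lambda>x. geom x n) has_field_derivative geom l n * geom_log_deriv l n) (at l)"
proof (cases "l = 1")
  case True
  have "((\<lambda>x. geom x n) has_field_derivative (\<Sum>i<n. real i * l ^ (i - Suc 0))) (at l)"
    unfolding geom_def by (auto intro!: derivative_eq_intros)
  also have "(\<Sum>i<n. real i * l ^ (i - Suc 0)) = (\<Sum>i<n. real i)"
    using True by simp
  also have "\<dots> = real n * (real n - 1) / 2"
    by (induction n) (auto simp: field_simps)
  finally show ?thesis using True by (simp add: geom_one geom_log_deriv_def)
next
  case False
  have "((\<lambda>x. (x ^ n - 1) / (x - 1)) has_field_derivative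
      (real n * l ^ (n - 1) * (l - 1) - (l ^ n - 1)) / ((l - 1) * (l - 1))) (at l)"
    using False by (auto intro!: derivative_eq_intros)
  also have "(real n * l ^ (n - 1) * (l - 1) - (l ^ n - 1)) / ((l - 1) * (l - 1)) =
      geom l n * geom_log_deriv l n"
  proof -
    have n1: "l ^ n - 1 \<noteq> 0" "l - 1 \<noteq> 0" using power_neq_one[OF assms(1) False assms(2)] False by auto
    have "1 + Psi l (int n) = l ^ n / (l ^ n - 1)"
      using n1 assms by (simp add: Psi_nat field_simps)
    moreover have "l ^ n = l * l ^ (n - 1)" using assms(2) by (cases n) auto
    ultimately have "geom_log_deriv l n = real n * l ^ (n - 1) / (l ^ n - 1) - 1 / (l - 1)"
      using False assms(1) by (simp add: geom_log_deriv_def)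
    moreover have "(a * Q - P) / (Q * Q) = P / Q * (a / P - 1 / Q)" if "P \<noteq> 0" "Q \<noteq> 0" for a P Q :: real
      using that by (simp add: field_simps)
    ultimately show ?thesis using n1 False by (simp add: geom_closed)
  qed
  finally have "((\<lambda>x. (x ^ n - 1) / (x - 1)) has_field_derivative geom l n * geom_log_deriv l n) (at l)" .
  then show ?thesis
    by (rule has_field_derivative_transform_within_open[of _ _ _ "- {1}"])
      (use False in \<open>auto simp: geom_closed\<close>)
qed

definition weight_log_deriv :: "real \<Rightarrow> nat \<Rightarrow> real" where
  "weight_log_deriv l n =
     (if l = 1 then 1 / 2
      else (real n * Psi l (int n) - real (Suc n) * Psi l (int (Suc n))) / l)"

lemma weight_has_derivative:
  assumes "l > 0" "n > 0"
  shows "((\<lambda>x. weight x n) has_field_derivative weight l n * weight_log_deriv l n) (at l)"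
proof -
  have g: "geom l n > 0" "geom l (Suc n) > 0" using assms geom_pos by auto
  have "((\<lambda>x. x * geom x n / geom x (Suc n)) has_field_derivative
      ((geom l n + l * (geom l n * geom_log_deriv l n)) * geom l (Suc n)
        - l * geom l n * (geom l (Suc n) * geom_log_deriv l (Suc n))) /
      (geom l (Suc n) * geom l (Suc n))) (at l)"
    using g assms geom_has_derivative[OF assms(1), of n] geom_has_derivative[OF assms(1), of "Suc n"]
    by (intro DERIV_divide) (auto intro!: derivative_eq_intros)
  also have "((geom l n + l * (geom l n * geom_log_deriv l n)) * geom l (Suc n)
        - l * geom l n * (geom l (Suc n) * geom_log_deriv l (Suc n))) /
      (geom l (Suc n) * geom l (Suc n)) =
      weight l n * (1 / l + geom_log_deriv l n - geom_log_deriv l (Suc n))"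
    using g assms by (simp add: weight_def field_simps)
  also have "1 / l + geom_log_deriv l n - geom_log_deriv l (Suc n) = weight_log_deriv l n"
    using assms by (simp add: geom_log_deriv_def weight_log_deriv_def field_simps)
  finally show ?thesis by (simp add: weight_def)
qed

text \<open>
  The difference \<open>1 / weight l n - weight l (n - 1)\<close> is \<open>Delta\<close> relative to the value at a vertex
  with \<open>d_out = n\<close>: going up divides by a weight, going down the shortest way out multiplies by the
  next one.
\<close>

lemma weight_gap_one:
  assumes "n > 0"
  shows "1 / weight 1 n - weight 1 (n - 1) = 2 / real n"
  using assms by (simp add: weight_def geom_one of_nat_diff field_simps)

lemma weight_gap:
  assumes "l > 0" "l \<noteq> 1" "n > 0"
  shows "1 / weight l n - weight l (n - 1) = (l + 1) * (l - 1) / l * Psi l (int n)"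
proof -
  obtain m where m: "n = Suc m" using assms(3) by (cases n) auto
  have g: "geom l n > 0" "geom l (Suc n) > 0" using assms geom_pos by auto
  have "1 / weight l n - weight l (n - 1) = (geom l (Suc n) / l - l * geom l m) / geom l n"
    using g assms m by (simp add: weight_def diff_divide_distrib)
  also have "geom l (Suc n) / l - l * geom l m = (l + 1) / l"
    using assms m by (simp add: geom_Suc field_simps)
  also have "(l + 1) / l / geom l n = (l + 1) * (l - 1) / l * Psi l (int n)"
    using assms power_neq_one[OF assms] by (simp add: geom_closed Psi_nat)
  finally show ?thesis .
qed

lemma prod_list_log_derivative:
  fixes f :: "'b \<Rightarrow> real \<Rightarrow> real"
  assumes "\<And>w. w \<in> set xs \<Longrightarrow> (f w has_field_derivative f w l * L w) (at l)"
  shows "((\<lambda>x. \<Prod>w\<leftarrow>xs. f w x) has_field_derivative (\<Prod>w\<leftarrow>xs. f w l) * (\<Sum>w\<leftarrow>xs. L w)) (at l)"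
  using assms
proof (induction xs)
  case (Cons w xs)
  have "((\<lambda>x. f w x * (\<Prod>w\<leftarrow>xs. f w x)) has_field_derivative
      f w l * L w * (\<Prod>w\<leftarrow>xs. f w l) + (\<Prod>w\<leftarrow>xs. f w l) * (\<Sum>w\<leftarrow>xs. L w) * f w l) (at l)"
    using Cons by (intro DERIV_mult) auto
  then show ?case by (simp add: algebra_simps)
qed simp

context root_reward_tree
begin

section \<open>The value function\<close>

definition tree_value :: "real \<Rightarrow> 'a \<Rightarrow> real" where
  "tree_value l v = (\<Prod>w\<leftarrow>tl (path_to v). weight l (d_out w))"

lemma tree_value_root: "tree_value l r = 1"
  by (simp add: tree_value_def path_to_root)

lemma tree_value_parent:
  assumes "v \<in> pverts G" "v \<noteq> r"
  shows "tree_value l v = tree_value l (parent v) * weight l (d_out v)"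
  using path_to_nonempty[OF parent_in_verts[OF assms]]
  by (simp add: tree_value_def path_to_parent[OF assms])

lemma tree_value_child:
  "c \<in> children v \<Longrightarrow> tree_value l c = tree_value l v * weight l (d_out c)"
  using tree_value_parent[OF child_in_verts child_neq_root] parent_child by metis

lemma tree_value_nonneg:
  assumes "l > 0"
  shows "tree_value l v \<ge> 0"
proof -
  have "weight l n \<ge> 0" for n
    using assms weight_pos[of l n] weight_zero[of l] by (cases n) (auto simp: less_imp_le)
  then show ?thesis
    unfolding tree_value_def by (intro prod_list_nonneg) auto
qed

lemma tree_value_leaf: "v \<in> leaves \<Longrightarrow> tree_value l v = payoff v"
  using tree_value_parent[of v l] d_out_leaf[of v]
  by (cases "v = r") (auto simp: tree_value_root payoff_def weight_zero leaves_def)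

lemma weighted_average_iff:
  fixes l :: real
  assumes "l > 0"
  shows "x = l / (l + 1) * a + 1 / (l + 1) * b \<longleftrightarrow> (l + 1) * x = l * a + b"
proof -
  have avg: "l / (l + 1) * a + 1 / (l + 1) * b = (l * a + b) / (l + 1)"
    by (simp add: add_divide_distrib)
  show ?thesis unfolding avg using assms by (simp add: eq_divide_eq mult.commute)
qed

text \<open>
  All weights are at most \<open>1\<close>, so values do not increase away from the root and the parent is a
  best neighbour.
\<close>

lemma Max_tree_value:
  assumes "l > 0" "v \<in> non_leaves"
  shows "Max (tree_value l ` nbrs v) = tree_value l (parent v)"
proof (rule Max_eqI)
  note v = non_leavesD(1,2)[OF assms(2)]
  show "finite (tree_value l ` nbrs v)" using finite_nbrs by simp
  show "tree_value l (parent v) \<in> tree_value l ` nbrs v" using nbrs_eq[OF v] by simp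
  fix y assume "y \<in> tree_value l ` nbrs v"
  then consider "y = tree_value l (parent v)" | c where "c \<in> children v" "y = tree_value l c"
    using nbrs_eq[OF v] by auto
  then show "y \<le> tree_value l (parent v)"
  proof cases
    case 2
    have "tree_value l c \<le> tree_value l v"
      using tree_value_child[OF 2(1)] tree_value_nonneg weight_le_one assms(1)
      by (simp add: mult_left_le)
    also have "\<dots> \<le> tree_value l (parent v)"
      using tree_value_parent[OF v] tree_value_nonneg weight_le_one assms(1)
      by (simp add: mult_left_le)
    finally show ?thesis using 2 by simp
  qed simp
qed

text \<open>
  Weights do not decrease when \<open>d_out\<close> grows, so a child nearest to an exit is a worst neighbour.
\<close>

lemma Min_tree_value:
  assumes "l > 0" "v \<in> non_leaves"
  shows "Min (tree_value l ` nbrs v) = tree_value l v * weight l (d_out v - 1)"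
proof (rule Min_eqI)
  note v = non_leavesD(1,2)[OF assms(2)]
  show "finite (tree_value l ` nbrs v)" using finite_nbrs by simp
  obtain c where c: "c \<in> children v" "d_out v = Suc (d_out c)"
    using ex_mainline_child[OF assms(2)] by blast
  then show "tree_value l v * weight l (d_out v - 1) \<in> tree_value l ` nbrs v"
    using nbrs_eq[OF v] tree_value_child[OF c(1), of l] by (intro image_eqI[of _ _ c]) auto
  have nn: "tree_value l v \<ge> 0" using tree_value_nonneg assms(1) by blast
  fix y assume "y \<in> tree_value l ` nbrs v"
  then consider "y = tree_value l (parent v)" | c where "c \<in> children v" "y = tree_value l c"
    using nbrs_eq[OF v] by auto
  then show "tree_value l v * weight l (d_out v - 1) \<le> y"
  proof cases
    case 1
    have "tree_value l v * weight l (d_out v - 1) \<le> tree_value l v"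
      using nn weight_le_one assms(1) by (simp add: mult_left_le)
    also have "\<dots> \<le> tree_value l (parent v)"
      using tree_value_parent[OF v] tree_value_nonneg weight_le_one assms(1)
      by (simp add: mult_left_le)
    finally show ?thesis using 1 by simp
  next
    case 2
    have "weight l (d_out v - 1) \<le> weight l (d_out c)"
      using weight_mono assms(1) d_out_le_child[OF 2(1)] by simp
    then show ?thesis using 2 tree_value_child[OF 2(1)] nn by (simp add: mult_left_mono)
  qed
qed

lemma is_value_tree_value:
  assumes "l > 0"
  shows "is_value l (restrict (tree_value l) (pverts G))"
proof -
  have "restrict (tree_value l) (pverts G) \<in> pverts G \<rightarrow>\<^sub>E {0..}"
    using tree_value_nonneg[OF assms] by auto
  moreover have "restrict (tree_value l) (pverts G) v = payoff v" if "v \<in> leaves" for v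
    using that tree_value_leaf by (simp add: leaves_def)
  moreover have "restrict (tree_value l) (pverts G) v =
      l / (l + 1) * Max (restrict (tree_value l) (pverts G) ` nbrs v)
      + 1 / (l + 1) * Min (restrict (tree_value l) (pverts G) ` nbrs v)" if v: "v \<in> non_leaves" for v
  proof -
    note vv = non_leavesD(1,2)[OF v]
    have im: "restrict (tree_value l) (pverts G) ` nbrs v = tree_value l ` nbrs v"
      by (rule image_cong) (auto simp: nbrs_altdef dest: in_arcsD2)
    obtain m where m: "d_out v = Suc m" using d_out_pos[OF v] by (cases "d_out v") auto
    have "(l + 1) * tree_value l v =
        l * tree_value l (parent v) + tree_value l v * weight l (d_out v - 1)"
      using weight_recurrence[OF assms, of m] tree_value_parent[OF vv, of l] m
      by (metis (no_types, opaque_lifting) diff_Suc_1 distrib_left mult.assoc mult.commute)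
    then show ?thesis
      using vv unfolding im Max_tree_value[OF assms v] Min_tree_value[OF assms v]
      by (simp only: weighted_average_iff[OF assms] restrict_apply if_True)
  qed
  ultimately show ?thesis by (simp add: is_value_def)
qed

lemma arc_closed_set_full:
  assumes "v \<in> S" "v \<in> pverts G" "\<And>x y. x \<in> S \<Longrightarrow> (x, y) \<in> parcs G \<Longrightarrow> y \<in> S" "u \<in> pverts G"
  shows "u \<in> S"
proof -
  obtain p where p: "vwalk p G" "hd p = v" "last p = u"
    using vwalk_between[OF assms(2,4)] by blast
  have "hd p \<in> S \<longrightarrow> last p \<in> S"
    using p(1) by (induction p rule: vwalk_induct) (auto intro: assms(3))
  then show ?thesis using p assms(1) by simp
qed

text \<open>
  A maximum principle. Among the vertices where \<open>f - g\<close> is maximal, those with the largest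
  \<open>f\<close> are closed under taking neighbours: a neighbour where \<open>f\<close> is largest again maximises
  \<open>f - g\<close>, and cannot exceed \<open>f\<close> at the vertex itself, which leaves no room for \<open>f\<close> to vary. By
  connectedness the set contains the root, where \<open>f\<close> and \<open>g\<close> agree. Exchanging \<open>f\<close> and \<open>g\<close> gives
  uniqueness.
\<close>

lemma is_value_le:
  assumes l: "l > 0" and f: "is_value l f" and g: "is_value l g" and v: "v \<in> pverts G"
  shows "f v \<le> g v"
proof (rule ccontr)
  assume "\<not> f v \<le> g v"
  define M where "M = Max ((\<lambda>v. f v - g v) ` pverts G)"
  define S where "S = {v \<in> pverts G. f v - g v = M}"
  define T where "T = {v \<in> S. f v = Max (f ` S)}"
  have le_M: "f u - g u \<le> M" if "u \<in> pverts G" for u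
    unfolding M_def using that pair_finite_verts by (intro Max_ge) auto
  have "M > 0" using le_M[OF v] \<open>\<not> f v \<le> g v\<close> by linarith
  have "M \<in> (\<lambda>v. f v - g v) ` pverts G"
    unfolding M_def using v pair_finite_verts by (intro Max_in) auto
  then have "S \<noteq> {}" by (auto simp: S_def)
  have finS: "finite S" using pair_finite_verts by (simp add: S_def)
  have "Max (f ` S) \<in> f ` S" using \<open>S \<noteq> {}\<close> finS by (intro Max_in) auto
  then obtain t where t: "t \<in> T" by (auto simp: T_def)
  have not_leaf: "x \<notin> leaves" if "x \<in> T" for x
  proof
    assume "x \<in> leaves"
    then have "f x = g x" using f g by (simp add: is_value_def)
    then show False using that \<open>M > 0\<close> by (simp add: T_def S_def)
  qed
  have closed: "y \<in> T" if x: "x \<in> T" and xy: "(x, y) \<in> parcs G" for x y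
  proof -
    have xn: "x \<in> non_leaves" using not_leaf[OF x] x by (simp add: non_leaves_def T_def S_def)
    have yn: "y \<in> nbrs x" using xy by (simp add: nbrs_altdef)
    have nv: "u \<in> pverts G" if "u \<in> nbrs x" for u using that by (auto simp: nbrs_altdef dest: in_arcsD2)
    define a where "a = Max (f ` nbrs x)"
    define b where "b = Max (g ` nbrs x)"
    define c where "c = Min (f ` nbrs x)"
    define e where "e = Min (g ` nbrs x)"
    have bnd: "c \<le> f u" "f u \<le> a" "e \<le> g u" "g u \<le> b" if "u \<in> nbrs x" for u
      using that finite_nbrs by (auto simp: a_def b_def c_def e_def)
    have "a \<in> f ` nbrs x" "e \<in> g ` nbrs x"
      using yn finite_nbrs unfolding a_def e_def by (intro Max_in Min_in; auto)+
    then obtain u w where u: "u \<in> nbrs x" "f u = a" and w: "w \<in> nbrs x" "g w = e" by auto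
    have fx: "(l + 1) * f x = l * a + c" and gx: "(l + 1) * g x = l * b + e"
      using f g xn unfolding is_value_def weighted_average_iff[OF l] a_def b_def c_def e_def
      by blast+
    have fgx: "f x - g x = M" using x by (simp add: T_def S_def)
    \<comment> \<open>A minimiser for \<open>g\<close> bounds the difference of the minima by \<open>M\<close>, so the maxima must
      differ by \<open>M\<close> as well.\<close>
    have "c - e \<le> M" using bnd(1)[OF w(1)] le_M[OF nv[OF w(1)]] w(2) by linarith
    moreover have "(l + 1) * M = l * (a - b) + (c - e)"
      using fx gx fgx by (simp add: algebra_simps flip: fgx)
    ultimately have "l * M \<le> l * (a - b)" by (simp add: algebra_simps)
    then have ab: "M \<le> a - b" using l by simp
    have "u \<in> S" using le_M[OF nv[OF u(1)]] bnd(4)[OF u(1)] u ab nv[OF u(1)] by (simp add: S_def)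
    then have "a \<le> f x" using x finS u(2) by (auto simp: T_def)
    \<comment> \<open>The average of \<open>a\<close> and \<open>c\<close> is at least the larger of them, so \<open>f\<close> is constant near \<open>x\<close>.\<close>
    have "(l + 1) * a \<le> l * a + c" using \<open>a \<le> f x\<close> fx l by (metis add_pos_pos mult_left_mono less_imp_le zero_less_one)
    then have "a \<le> c" by (simp add: algebra_simps)
    then have "f y = a" "c = a"
      using bnd(1,2)[OF yn] by auto
    then have "(l + 1) * f x = (l + 1) * a"
      using fx by (simp add: algebra_simps)
    then have "f x = a"
      using l by simp
    moreover have "f y - g y = M" using \<open>f y = a\<close> ab bnd(4)[OF yn] le_M[OF nv[OF yn]] by linarith
    ultimately show "y \<in> T" using \<open>f y = a\<close> x nv[OF yn] by (simp add: T_def S_def)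
  qed
  have "t \<in> pverts G" using t by (simp add: T_def S_def)
  from arc_closed_set_full[OF t this closed root_in_verts] have "r \<in> T" .
  from not_leaf[OF this] root_in_leaves show False by simp
qed

lemma h_eq_tree_value:
  assumes "l > 0" "v \<in> pverts G"
  shows "h l v = tree_value l v"
proof -
  note tv = is_value_tree_value[OF assms(1)]
  have "h l = restrict (tree_value l) (pverts G)"
    unfolding h_def
  proof (rule the_equality)
    fix f assume f: "is_value l f"
    show "f = restrict (tree_value l) (pverts G)"
    proof (rule PiE_ext)
      show "f \<in> pverts G \<rightarrow>\<^sub>E {0..}" "restrict (tree_value l) (pverts G) \<in> pverts G \<rightarrow>\<^sub>E {0..}"
        using f tv by (auto simp only: is_value_def)
      show "f u = restrict (tree_value l) (pverts G) u" if "u \<in> pverts G" for u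
        using is_value_le[OF assms(1) f tv that] is_value_le[OF assms(1) tv f that] by (rule antisym)
    qed
  qed (rule tv)
  then show ?thesis using assms(2) by simp
qed

section \<open>The stake as a sum along the path\<close>

lemma parent_root_or_non_leaf:
  assumes "v \<in> pverts G" "v \<noteq> r"
  shows "parent v = r \<or> parent v \<in> non_leaves"
proof -
  have "v \<in> children (parent v)"
    using parent_arc[OF assms] d_in_parent[OF assms] by (simp add: children_def)
  then show ?thesis
    using parent_in_verts[OF assms] leaf_iff[of "parent v"] by (auto simp: non_leaves_def)
qed

text \<open>
  This makes every factor of \<open>tree_value\<close> at an inner vertex positive, as needed for
  logarithmic derivatives.
\<close>

lemma path_to_non_leaf:
  assumes "v \<in> non_leaves" "w \<in> set (tl (path_to v))"
  shows "w \<in> non_leaves"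
  using assms
proof (induction "d_in v" arbitrary: v)
  case 0
  then show ?case using d_in_zero non_leavesD by metis
next
  case (Suc n)
  note v = non_leavesD(1,2)[OF Suc.prems(1)]
  have "w = v \<or> w \<in> set (tl (path_to (parent v)))"
    using Suc.prems(2) path_to_parent[OF v] path_to_nonempty[OF parent_in_verts[OF v]] by auto
  then show ?case
  proof
    assume w: "w \<in> set (tl (path_to (parent v)))"
    then have "parent v \<in> non_leaves"
      using parent_root_or_non_leaf[OF v] path_to_root by auto
    then show ?thesis
      using Suc.hyps(1)[of "parent v"] Suc.hyps(2) d_in_parent[OF v] w by simp
  qed (use Suc.prems in simp)
qed

lemma tree_value_pos:
  assumes "l > 0" "v \<in> non_leaves"
  shows "tree_value l v > 0"
proof -
  have "weight l (d_out w) \<noteq> 0" if "w \<in> set (tl (path_to v))" for w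
    using weight_pos[OF assms(1) d_out_pos[OF path_to_non_leaf[OF assms(2) that]]] by simp
  then have "tree_value l v \<noteq> 0"
    by (auto simp: tree_value_def prod_list_zero_iff)
  then show ?thesis using tree_value_nonneg[OF assms(1), of v] by simp
qed

lemma deriv_h:
  assumes "l > 0" "v \<in> non_leaves"
  shows "deriv (\<lambda>x. h x v) l =
    tree_value l v * (\<Sum>w\<leftarrow>tl (path_to v). weight_log_deriv l (d_out w))"
proof (rule DERIV_imp_deriv)
  let ?D = "tree_value l v * (\<Sum>w\<leftarrow>tl (path_to v). weight_log_deriv l (d_out w))"
  have "((\<lambda>x. tree_value x v) has_field_derivative ?D) (at l)"
    unfolding tree_value_def
    by (intro prod_list_log_derivative weight_has_derivative assms(1) d_out_pos
        path_to_non_leaf[OF assms(2)])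
  then show "((\<lambda>x. h x v) has_field_derivative ?D) (at l)"
    by (rule has_field_derivative_transform_within_open[of _ _ _ "{0<..}"])
      (use assms non_leavesD(1) h_eq_tree_value in auto)
qed

text \<open>
  Both \<open>Delta\<close> and the derivative of \<open>h\<close> are multiples of the positive number \<open>tree_value l v\<close>.
\<close>

lemma Stake_eq:
  assumes "l > 0" "v \<in> non_leaves"
  shows "Stake 1 l v = (1 / weight l (d_out v) - weight l (d_out v - 1)) /
    ((l + 1)\<^sup>2 * (\<Sum>j\<in>{0<..d_in v}. weight_log_deriv l (d_out (path_to v ! j))))"
proof -
  note v = non_leavesD(1,2)[OF assms(2)]
  let ?L = "\<Sum>w\<leftarrow>tl (path_to v). weight_log_deriv l (d_out w)"
  have "h l ` nbrs v = tree_value l ` nbrs v"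
    by (rule image_cong) (auto simp: nbrs_altdef h_eq_tree_value[OF assms(1)] dest: in_arcsD2)
  then have "Delta l v = tree_value l (parent v) - tree_value l v * weight l (d_out v - 1)"
    unfolding Delta_def using Max_tree_value[OF assms] Min_tree_value[OF assms] by simp
  also have "tree_value l (parent v) = tree_value l v / weight l (d_out v)"
    using tree_value_parent[OF v, of l] weight_pos[OF assms(1) d_out_pos[OF assms(2)]] by simp
  finally have "Delta l v = tree_value l v * (1 / weight l (d_out v) - weight l (d_out v - 1))"
    by (simp add: right_diff_distrib)
  then have "Stake 1 l v = tree_value l v * (1 / weight l (d_out v) - weight l (d_out v - 1)) /
      (tree_value l v * ((l + 1)\<^sup>2 * ?L))"
    unfolding Stake_def deriv_h[OF assms] by (simp add: mult.left_commute)
  also have "\<dots> = (1 / weight l (d_out v) - weight l (d_out v - 1)) / ((l + 1)\<^sup>2 * ?L)"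
    using tree_value_pos[OF assms] by simp
  also have "?L = (\<Sum>i<d_in v. weight_log_deriv l (d_out (path_to v ! Suc i)))"
    using length_path_to[OF v(1)] by (simp add: sum_list_sum_nth nth_tl atLeast0LessThan)
  also have "\<dots> = (\<Sum>j\<in>{0<..d_in v}. weight_log_deriv l (d_out (path_to v ! j)))"
    by (rule sum.reindex_bij_witness[of _ "\<lambda>j. j - 1" Suc]) auto
  finally show ?thesis .
qed

section \<open>The journey data\<close>

lemma d_in_walk_le:
  assumes "vwalk p G"
  shows "d_in (last p) \<le> d_in (hd p) + (length p - 1)"
  using assms
proof (induction p rule: vwalk_induct)
  case (Cons u v es)
  then show ?case using d_in_arc_le[of u v] by simp
qed simp

text \<open>
  The root path is a geodesic between any two of its vertices, since each step of any walk changes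
  the depth by at most one.
\<close>

lemma gdist_path_to:
  assumes "v \<in> pverts G" "i \<le> j" "j < length (path_to v)"
  shows "gdist (path_to v ! i) (path_to v ! j) = j - i"
proof (rule antisym)
  let ?p = "path_to v"
  have sub: "set (vwalk_arcs xs) \<subseteq> set (vwalk_arcs (ys @ xs @ zs))" for xs ys zs :: "'a list"
    using set_vwalk_arcs_append1[of "xs" zs] set_vwalk_arcs_append2[of "xs @ zs" ys] by blast
  define q where "q = drop i (take (Suc j) ?p)"
  have q: "length q = Suc (j - i)" "hd q = ?p ! i" "last q = ?p ! j" "q \<noteq> []"
    using assms(2,3) by (auto simp: q_def hd_drop_conv_nth last_conv_nth)
  have "?p = take i ?p @ q @ drop (Suc j) ?p"
    using assms(2) unfolding q_def
    by (metis append_assoc append_take_drop_id le_SucI min.absorb1 take_take)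
  then have "set q \<subseteq> set ?p" "set (vwalk_arcs q) \<subseteq> set (vwalk_arcs ?p)"
    using sub[of q "take i ?p" "drop (Suc j) ?p"] by (metis set_append sup_ge1 sup_ge2 order_trans, simp)
  then have "vwalk q G"
    using vpath_path_to[OF assms(1)] q(4) by (auto simp: vpath_def vwalk_def)
  from gdist_le_walk[OF this] show "gdist (?p ! i) (?p ! j) \<le> j - i" using q by simp
next
  let ?p = "path_to v"
  obtain q where q: "vwalk q G" "hd q = ?p ! i" "last q = ?p ! j" "length q = Suc (gdist (?p ! i) (?p ! j))"
    using geodesic_exists[of "?p ! i" "?p ! j"] path_to_nth_in_verts assms by auto
  then show "j - i \<le> gdist (?p ! i) (?p ! j)"
    using d_in_walk_le[OF q(1)] d_in_path_to_nth[OF assms(1)] assms(2,3) by simp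
qed

end

lemma filter_upt_gap:
  fixes Q :: "nat \<Rightarrow> bool"
  assumes "Suc i < length (filter Q [0..<m])"
    and "filter Q [0..<m] ! i < j" "j < filter Q [0..<m] ! Suc i"
  shows "\<not> Q j"
proof
  let ?xs = "filter Q [0..<m]"
  assume "Q j"
  have s: "sorted_wrt (<) ?xs" by (rule sorted_wrt_filter) simp
  have "?xs ! Suc i \<in> set ?xs" using assms(1) nth_mem by blast
  then have "j \<in> set ?xs" using \<open>Q j\<close> assms(3) by auto
  then obtain t where t: "t < length ?xs" "?xs ! t = j" by (auto simp only: in_set_conv_nth)
  have "\<not> t \<le> i"
    using sorted_wrt_nth_less[OF s, of t i] assms(1,2) t by (cases "t = i") auto
  moreover have "\<not> Suc i \<le> t"
    using sorted_wrt_nth_less[OF s, of "Suc i" t] assms(3) t by (cases "t = Suc i") auto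
  ultimately show False by simp
qed

lemma sum_consecutive_segments:
  fixes J :: "nat \<Rightarrow> nat" and f :: "nat \<Rightarrow> 'b::comm_monoid_add"
  assumes "\<And>i. i \<le> k \<Longrightarrow> J i \<le> J (Suc i)"
  shows "(\<Sum>i\<le>k. \<Sum>j\<in>{J i<..J (Suc i)}. f j) = (\<Sum>j\<in>{J 0<..J (Suc k)}. f j)"
  using assms
proof (induction k)
  case (Suc k)
  note step = Suc.prems
  have mono: "J 0 \<le> J (Suc i)" if "i \<le> k" for i
    using that
  proof (induction i)
    case (Suc i)
    then show ?case using step[of "Suc i"] by simp
  qed (use step[of 0] in simp)
  have "{J 0<..J (Suc (Suc k))} = {J 0<..J (Suc k)} \<union> {J (Suc k)<..J (Suc (Suc k))}"
    using mono[of k] step[of "Suc k"] by (simp add: ivl_disj_un_two)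
  then have "(\<Sum>j\<in>{J 0<..J (Suc (Suc k))}. f j) =
      (\<Sum>j\<in>{J 0<..J (Suc k)}. f j) + (\<Sum>j\<in>{J (Suc k)<..J (Suc (Suc k))}. f j)"
    by (simp add: sum.union_disjoint ivl_disj_int)
  then show ?case using Suc by simp
qed simp

lemma sum_mainline_telescopes:
  fixes F :: "nat \<Rightarrow> real"
  assumes "a \<le> b" "\<And>j. a < j \<Longrightarrow> j \<le> b \<Longrightarrow> D j = D b + (b - j)"
  shows "(\<Sum>j\<in>{a<..b}. F (D j) - F (Suc (D j))) = F (D b) - F (D b + (b - a))"
  using assms
proof (induction a rule: inc_induct)
  case (step a)
  have "{a<..b} = insert (Suc a) {Suc a<..b}" using step.hyps by auto
  moreover have "D (Suc a) = D b + (b - Suc a)"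
    by (rule step.prems) (use step.hyps in auto)
  moreover have "b - a = Suc (b - Suc a)" using step.hyps by simp
  moreover have "(\<Sum>j\<in>{Suc a<..b}. F (D j) - F (Suc (D j))) = F (D b) - F (D b + (b - Suc a))"
    by (rule step.IH, rule step.prems) auto
  ultimately show ?case by simp
qed simp

context root_reward_tree
begin

text \<open>
  Along an edge away from the root the span cannot decrease, and it increases only below a
  junction. Hence between consecutive junctions \<open>d_out\<close> drops by one at each step.
\<close>

lemma journey_data_segments:
  assumes "v \<in> non_leaves"
    and "journey_data v = map (\<lambda>i. (s i, d i)) [0..<Suc k]"
  obtains J where "J 0 = 0" "J (Suc k) = d_in v"
    and "\<And>i. i \<le> k \<Longrightarrow> J i < J (Suc i)"
    and "\<And>i. i \<le> k \<Longrightarrow> d i = J (Suc i) - J i"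
    and "\<And>i. i \<le> k \<Longrightarrow> s i = d i + d_out (path_to v ! J (Suc i))"
    and "\<And>i j. i \<le> k \<Longrightarrow> J i < j \<Longrightarrow> j \<le> J (Suc i) \<Longrightarrow>
      d_out (path_to v ! j) = d_out (path_to v ! J (Suc i)) + (J (Suc i) - j)"
proof -
  note v = non_leavesD(1,2)[OF assms(1)]
  let ?p = "path_to v" and ?n = "d_in v"
  define Q where "Q i \<longleftrightarrow> i = 0 \<or> i = ?n \<or> vspan (?p ! Suc i) > vspan (?p ! i)" for i
  define xs where "xs = filter Q [0..<Suc ?n]"
  note len_p = length_path_to[OF v(1)]
  have js: "junctions v = map (\<lambda>i. ?p ! i) xs"
    by (simp add: junctions_def Let_def len_p xs_def Q_def[abs_def] del: upt_Suc)
  have len_js: "length (junctions v) - 1 = Suc k"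
    using arg_cong[OF assms(2), of length] by (simp add: journey_data_def Let_def)
  then have len: "length xs = Suc (Suc k)" by (simp add: js)
  have sorted: "sorted_wrt (<) xs" unfolding xs_def by (rule sorted_wrt_filter) (simp del: upt_Suc)
  have set_xs: "j \<in> set xs \<longleftrightarrow> j \<le> ?n \<and> Q j" for j
    by (auto simp: xs_def simp del: upt_Suc)
  have bound: "xs ! i \<le> ?n" if "i \<le> Suc k" for i
    using that len set_xs[of "xs ! i"] by simp
  have mono: "xs ! i < xs ! Suc i" if "i \<le> k" for i
    using sorted_wrt_nth_less[OF sorted, of i "Suc i"] that len by simp
  have sd: "s i = d i + d_out (?p ! (xs ! Suc i)) \<and> d i = xs ! Suc i - xs ! i" if "i \<le> k" for i
  proof -
    have "(s i, d i) = journey_data v ! i"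
      using that assms(2) by (simp del: upt_Suc)
    also have "\<dots> = (let d = gdist (?p ! (xs ! i)) (?p ! (xs ! Suc i)) in (d + d_out (?p ! (xs ! Suc i)), d))"
      using that len by (simp add: journey_data_def Let_def js del: upt_Suc)
    finally show ?thesis
      using gdist_path_to[OF v(1), of "xs ! i" "xs ! Suc i"] mono[OF that] bound[of "Suc i"] that len_p
      by (simp add: Let_def)
  qed
  have "0 \<in> set xs" "?n \<in> set xs" by (auto simp: set_xs Q_def)
  then obtain a b where a: "a < length xs" "xs ! a = 0" and b: "b < length xs" "xs ! b = ?n"
    by (auto simp only: in_set_conv_nth)
  have first: "xs ! 0 = 0"
    using sorted_wrt_nth_less[OF sorted, of 0 a] a by (cases "a = 0") auto
  have last: "xs ! Suc k = ?n"
    using sorted_wrt_nth_less[OF sorted, of b "Suc k"] b bound[of "Suc k"] len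
    by (cases "b = Suc k") auto
  have seg: "d_out (?p ! j) = d_out (?p ! (xs ! Suc i)) + (xs ! Suc i - j)"
    if i: "i \<le> k" and j: "xs ! i < j" "j \<le> xs ! Suc i" for i j
    using j(2,1)
  proof (induction j rule: inc_induct)
    case (step j)
    have "\<not> Q j"
      using filter_upt_gap[of i Q "Suc ?n" j] step i len unfolding xs_def by simp
    then have "vspan (?p ! Suc j) \<le> vspan (?p ! j)" by (simp add: Q_def)
    moreover have jn: "Suc j < length ?p" using step.hyps bound[of "Suc i"] i len_p by simp
    moreover have "d_out (?p ! j) \<le> Suc (d_out (?p ! Suc j))"
      using d_out_le_child[OF path_to_nth_child[OF v(1) jn]] .
    ultimately have "d_out (?p ! j) = Suc (d_out (?p ! Suc j))"
      using d_in_path_to_nth[OF v(1), of j] d_in_path_to_nth[OF v(1), of "Suc j"] by (simp add: vspan_def)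
    then show ?case using step by simp
  qed simp
  show thesis
    by (rule that[of "\<lambda>i. xs ! i", OF first last mono conjunct2[OF sd] conjunct1[OF sd] seg])
qed

end

section \<open>The stake in terms of the journey data\<close>

lemma stake_off_one:
  fixes l P S :: real
  assumes "l > 0"
  shows "(l + 1) * (l - 1) / l * P / ((l + 1)\<^sup>2 * (S / l)) = (l - 1) * P / ((l + 1) * S)"
proof -
  have "(l + 1) * (l - 1) / l * P / ((l + 1)\<^sup>2 * (S / l)) =
      ((l + 1) / l) * ((l - 1) * P) / (((l + 1) / l) * ((l + 1) * S))"
    by (simp add: power2_eq_square)
  then show ?thesis using assms by (simp only: mult_divide_mult_cancel_left) simp
qed

theorem theorem4p14:
  fixes G :: "'a pair_pre_digraph" and r v :: 'a
    and s d :: "nat \<Rightarrow> nat" and k :: nat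
  assumes "root_reward_tree G r"
    and "v \<in> root_reward_tree.non_leaves G"
    and "root_reward_tree.journey_data G r v = map (\<lambda>i. (s i, d i)) [0..<Suc k]"
  shows "(\<forall>l::real. 0 < l \<and> l \<noteq> 1 \<longrightarrow>
           root_reward_tree.Stake G r 1 l v =
             (l - 1) * Psi l (int (s k) - int (d k)) /
             ((l + 1) * (\<Sum>i\<le>k. (real (s i) - real (d i)) * Psi l (int (s i) - int (d i))
                                  - real (s i) * Psi l (int (s i))))) \<and>
         root_reward_tree.Stake G r 1 1 v =
           inverse ((real (s k) - real (d k)) * (\<Sum>i\<le>k. real (d i)))"
proof -
  interpret root_reward_tree G r by fact
  note v = non_leavesD(1,2)[OF assms(2)]
  define D where "D j = d_out (path_to v ! j)" for j
  obtain J where J0: "J 0 = 0" and Jk: "J (Suc k) = d_in v"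
    and mono: "\<And>i. i \<le> k \<Longrightarrow> J i < J (Suc i)"
    and d: "\<And>i. i \<le> k \<Longrightarrow> d i = J (Suc i) - J i"
    and s: "\<And>i. i \<le> k \<Longrightarrow> s i = d i + D (J (Suc i))"
    and seg: "\<And>i j. i \<le> k \<Longrightarrow> J i < j \<Longrightarrow> j \<le> J (Suc i) \<Longrightarrow> D j = D (J (Suc i)) + (J (Suc i) - j)"
    using journey_data_segments[OF assms(2,3)] unfolding D_def by blast
  have sum_path: "(\<Sum>j\<in>{0<..d_in v}. f j) = (\<Sum>i\<le>k. \<Sum>j\<in>{J i<..J (Suc i)}. f j)" for f :: "nat \<Rightarrow> real"
    using sum_consecutive_segments[of k J f] mono J0 Jk by (simp add: less_imp_le)
  have "path_to v ! d_in v = v"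
    using last_path_to[OF v(1)] length_path_to[OF v(1)] path_to_nonempty[OF v(1)]
    by (simp add: last_conv_nth)
  then have out_v: "s k - d k = d_out v" "d k \<le> s k"
    using s[of k] Jk by (simp_all add: D_def)
  note pos = d_out_pos[OF assms(2)]
  show ?thesis
  proof (intro conjI allI impI)
    fix l :: real
    assume "0 < l \<and> l \<noteq> 1"
    then have l: "l > 0" "l \<noteq> 1" by auto
    define F where "F m = real m * Psi l (int m)" for m
    let ?S = "\<Sum>i\<le>k. (real (s i) - real (d i)) * Psi l (int (s i) - int (d i))
                                  - real (s i) * Psi l (int (s i))"
    have "(\<Sum>j\<in>{0<..d_in v}. weight_log_deriv l (D j)) =
        (\<Sum>j\<in>{0<..d_in v}. F (D j) - F (Suc (D j))) / l"
      using l by (simp add: weight_log_deriv_def F_def sum_divide_distrib)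
    also have "(\<Sum>j\<in>{0<..d_in v}. F (D j) - F (Suc (D j))) = ?S"
      unfolding sum_path
    proof (rule sum.cong)
      fix i assume "i \<in> {..k}"
      then have i: "i \<le> k" by simp
      have sd: "D (J (Suc i)) = s i - d i" "s i - d i + (J (Suc i) - J i) = s i" "d i \<le> s i"
        using s[OF i] d[OF i] by auto
      have "(\<Sum>j\<in>{J i<..J (Suc i)}. F (D j) - F (Suc (D j))) =
          F (D (J (Suc i))) - F (D (J (Suc i)) + (J (Suc i) - J i))"
        by (rule sum_mainline_telescopes[OF less_imp_le[OF mono[OF i]] seg[OF i]])
      also have "\<dots> = F (s i - d i) - F (s i)"
        by (simp only: sd)
      finally show "(\<Sum>j\<in>{J i<..J (Suc i)}. F (D j) - F (Suc (D j))) =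
          (real (s i) - real (d i)) * Psi l (int (s i) - int (d i)) - real (s i) * Psi l (int (s i))"
        using sd(3) by (simp add: F_def of_nat_diff)
    qed simp
    finally have "Stake 1 l v = (l + 1) * (l - 1) / l * Psi l (int (d_out v)) / ((l + 1)\<^sup>2 * (?S / l))"
      unfolding Stake_eq[OF l(1) assms(2)] weight_gap[OF l pos] D_def by simp
    also have "\<dots> = (l - 1) * Psi l (int (s k) - int (d k)) / ((l + 1) * ?S)"
      unfolding stake_off_one[OF l(1)] using out_v by (simp flip: of_nat_diff)
    finally show "Stake 1 l v = (l - 1) * Psi l (int (s k) - int (d k)) / ((l + 1) * ?S)" .
  next
    have "real (d_in v) = (\<Sum>i\<le>k. real (d i))"
      using sum_path[of "\<lambda>_. 1"] d mono by simp
    then show "Stake 1 1 v = inverse ((real (s k) - real (d k)) * (\<Sum>i\<le>k. real (d i)))"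
      unfolding Stake_eq[OF zero_less_one assms(2)] weight_gap_one[OF pos]
      using out_v pos by (simp add: weight_log_deriv_def field_simps flip: of_nat_diff)
  qed
qed

end
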